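(* Let $$p(x,y)=p_{00}+p_{10}x+p_{01}y+\cdots+p_{n0}x^n+p_{n-1,1}x^{n-1}y+\cdots+p_{1,n-1}xy^{n-1}$$ be a bivariate polynomial of degree $n$ with complex coefficients such that $p_{n0}\ne 0$, $p_{0n}=p_{0,n-1}=0$, and all roots of $p_{n0}\xi^{n-1}+p_{n-1,1}\xi^{n-2}+\cdots+p_{1,n-1}=0$ are simple and nonzero. Then the following algorithm outputs $n\times n$ matrices $A,B,C$ such that $\det(A+xB+yC)=p(x,y)$. 1. Compute the roots $\xi_1,\ldots,\xi_{n-1}$ of $p_{n0}\xi^{n-1}+p_{n-1,1}\xi^{n-2}+\cdots+p_{1,n-1}=0$. 2. Set $q_0(x,y)=1$. 3. For $j=1,\ldots,n-1$: 4. set $q_j(x,y)=(x-\xi_j y)\,q_{j-1}(x,y)$. 5. Set $r(x,y)=p(x,y)-p_{n0}\,x\,q_{n-1}(x,y)$. 6. For $k=2,\ldots,n-1$ do steps 7–20: 7. $h(t)=(r_{n-k+1,0}t^{n-k}+r_{n-k,1}t^{n-k-1}+\cdots+r_{1,n-k})/p_{n0}$. 8. $\alpha_{n-1,k}=r_{n-k+1,0}/p_{n0}-n+k+1$. 9. $g(t)=h(t)-t\sum_{\ell=k}^{n-2}\prod_{i=1}^{\ell-k}(t-\xi_i)\prod_{j=\ell+1}^{n-1}(t-\xi_j)-\alpha_{n-1,k}\,t\prod_{i=1}^{n-k-1}(t-\xi_i)$. 10. For $m=1,\ldots,n-k$: 11. for $\ell=1,\ldots,m$: 12. set $w_{m\ell}=\prod_{i=1}^{\ell-1}(\xi_m-\xi_i)\prod_{j=\ell+k}^{n-1}(\xi_m-\xi_j)$.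 13. Solve the lower triangular linear system $$\begin{bmatrix} w_{11} & & & \\ w_{21} & w_{22} & & \\ \vdots & & \ddots & \\ w_{n-k,1} & w_{n-k,2} & \cdots & w_{n-k,n-k}\end{bmatrix}\begin{bmatrix}\beta_{kk}\\ \beta_{k+1,k}\\ \vdots\\ \beta_{n-1,k}\end{bmatrix}=\begin{bmatrix} g(\xi_1)\\ g(\xi_2)\\ \vdots\\ g(\xi_{n-k})\end{bmatrix}.$$ 14. Replace $q_k(x,y)$ by $q_k(x,y)+(x+\beta_{kk}y)\,q_0(x,y)$. 15. For $j=k+1,\ldots,n-2$: 16. set $q_j(x,y)=(x-\xi_j y)q_{j-1}(x,y)+\sum_{\ell=2}^{k}(x+\beta_{j\ell}y)q_{j-\ell}(x,y)$. 17. Set $q_{n-1}(x,y)=(x-\xi_{n-1}y)q_{n-2}(x,y)+\sum_{\ell=2}^{k}(\alpha_{n-1,\ell}x+\beta_{n-1,\ell}y)q_{n-1-\ell}(x,y)$. 18. $s(x,y)=p(x,y)-p_{n0}\,x\,q_{n-1}(x,y)-\sum_{\ell=2}^{k-1}\gamma_{n-\ell}\,q_{n-\ell}(x,y)$. 19. $\gamma_{n-k}=(-1)^{n-k}s_{0,n-k}/(\xi_1\cdots\xi_{n-k})$. 20. $r(x,y)=s(x,y)-\gamma_{n-k}\,q_{n-k}(x,y)$. Return $$A=\begin{bmatrix} r_{00} & \gamma_1 & \cdots & \gamma_{n-2} & 0\\ & 1 & & & \\ & & \ddots & & \\ & & & 1 & \\ & & & & 1\end{bmatrix},\qquad B=\begin{bmatrix}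 r_{10} & 0 & \cdots & 0 & p_{n0}\\ -1 & 0 & & & \\ \vdots & \ddots & \ddots & & \\ -1 & \cdots & -1 & 0 & \\ -\alpha_{n-1,n-1} & \cdots & -\alpha_{n-1,2} & -1 & 0\end{bmatrix},$$ $$C=\begin{bmatrix} 0 & & & & \\ -\beta_{11} & 0 & & & \\ -\beta_{22} & -\beta_{21} & 0 & & \\ \vdots & & \ddots & \ddots & \\ -\beta_{n-1,n-1} & -\beta_{n-1,n-2} & \cdots & -\beta_{n-1,1} & 0\end{bmatrix},$$ where $\beta_{i1}=-\xi_i$ for $i=1,\ldots,n-1$.
   Context: For a bivariate polynomial $f$, $f_{ij}$ denotes the coefficient of $x^iy^j$ in $f$; so $p_{ij}$, $r_{ij}$, $s_{ij}$ are the coefficients of the current polynomials $p$, $r$, $s$. Empty sums are $0$ and empty products are $1$. Entries left blank in the matrices are zero. In the returned matrices, $r_{00}$ and $r_{10}$ are the coefficients of the final $r$, and $\alpha_{n-1,k}$, $\beta_{ik}$ ($k\ge 2$), $\gamma_j$ are the values computed in the loop. *)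

theory Defs
  imports Complex_Main "HOL-Computational_Algebra.Polynomial" "Jordan_Normal_Form.Determinant"
begin

section \<open>Bivariate polynomials\<close>

text \<open>
  A polynomial in \<open>x\<close> and \<open>y\<close> is an element of \<open>complex poly poly\<close>:
  the outer variable is \<open>y\<close>, the inner one is \<open>x\<close>.
\<close>

type_synonym bipoly = "complex poly poly"

definition bconst :: "complex \<Rightarrow> bipoly" where
  "bconst c = [:[:c:]:]"

definition varx :: bipoly where
  "varx = [:[:0, 1:]:]"

definition vary :: bipoly where
  "vary = [:0, 1:]"

definition lin :: "complex \<Rightarrow> complex \<Rightarrow> bipoly" where
  "lin a b = bconst a * varx + bconst b * vary"

text \<open>\<open>bcoeff f i j\<close> is the coefficient of \<open>x ^ i * y ^ j\<close> in \<open>f\<close>.\<close>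

definition bcoeff :: "bipoly \<Rightarrow> nat \<Rightarrow> nat \<Rightarrow> complex" where
  "bcoeff f i j = coeff (coeff f j) i"

definition total_degree :: "bipoly \<Rightarrow> nat" where
  "total_degree f = Max (insert 0 {i + j | i j. bcoeff f i j \<noteq> 0})"

section \<open>The algorithm\<close>

definition lead_poly :: "bipoly \<Rightarrow> nat \<Rightarrow> complex poly" where
  "lead_poly p n = (\<Sum>i<n. monom (bcoeff p (n - i) i) (n - 1 - i))"

text \<open>
  An enumeration \<open>\<xi> 1, \<dots>, \<xi> (n - 1)\<close> of the roots, in any order; without repetition, since the
  algorithm is only used when all roots are simple.  Other values of \<open>\<xi>\<close> are never used.
\<close>

definition root_enumeration :: "bipoly \<Rightarrow> nat \<Rightarrow> (nat \<Rightarrow> complex) \<Rightarrow> bool" where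
  "root_enumeration p n \<xi> \<longleftrightarrow> bij_betw \<xi> {1..n - 1} {z. poly (lead_poly p n) z = 0}"

text \<open>
  The values of the program variables.  The field \<open>alpha\<close> holds the numbers with first index
  \<open>n - 1\<close> (the only ones occurring), so \<open>alpha st k\<close> is \<open>\<alpha>\<close> with indices \<open>n - 1, k\<close>.
\<close>

record alg_state =
  qs :: "nat \<Rightarrow> bipoly"
  res :: bipoly
  alpha :: "nat \<Rightarrow> complex"
  beta :: "nat \<Rightarrow> nat \<Rightarrow> complex"
  gamma :: "nat \<Rightarrow> complex"

text \<open>
  The values \<open>0\<close> are placeholders: no entry is read before the algorithm has set it.
\<close>

definition init_state :: "bipoly \<Rightarrow> nat \<Rightarrow> (nat \<Rightarrow> complex) \<Rightarrow> alg_state" where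
  "init_state p n \<xi> =
    (let q = fold (\<lambda>j q. q(j := lin 1 (- \<xi> j) * q (j - 1))) [1..<n] ((\<lambda>_. 0)(0 := 1))
     in \<lparr> qs = q,
          res = p - bconst (bcoeff p n 0) * varx * q (n - 1),
          alpha = (\<lambda>_. 0),
          beta = (\<lambda>i j. if j = 1 then - \<xi> i else 0),
          gamma = (\<lambda>_. 0) \<rparr>)"

definition h_poly :: "bipoly \<Rightarrow> nat \<Rightarrow> nat \<Rightarrow> bipoly \<Rightarrow> complex poly" where
  "h_poly p n k r =
    smult (1 / bcoeff p n 0) (\<Sum>i\<le>n - k. monom (bcoeff r (n - k + 1 - i) i) (n - k - i))"

definition alpha_val :: "bipoly \<Rightarrow> nat \<Rightarrow> nat \<Rightarrow> bipoly \<Rightarrow> complex" where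
  "alpha_val p n k r =
    bcoeff r (n - k + 1) 0 / bcoeff p n 0 - of_nat n + of_nat k + 1"

definition g_poly :: "bipoly \<Rightarrow> nat \<Rightarrow> (nat \<Rightarrow> complex) \<Rightarrow> nat \<Rightarrow> bipoly \<Rightarrow> complex poly" where
  "g_poly p n \<xi> k r =
    h_poly p n k r
    - [:0, 1:] * (\<Sum>l=k..n - 2. (\<Prod>i=1..l - k. [:- \<xi> i, 1:]) * (\<Prod>j=l + 1..n - 1. [:- \<xi> j, 1:]))
    - smult (alpha_val p n k r) ([:0, 1:] * (\<Prod>i=1..n - k - 1. [:- \<xi> i, 1:]))"

definition w_coef :: "nat \<Rightarrow> (nat \<Rightarrow> complex) \<Rightarrow> nat \<Rightarrow> nat \<Rightarrow> nat \<Rightarrow> complex" where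
  "w_coef n \<xi> k m l = (\<Prod>i=1..l - 1. \<xi> m - \<xi> i) * (\<Prod>j=l + k..n - 1. \<xi> m - \<xi> j)"

text \<open>Rows and columns of matrices and vectors are numbered from \<open>0\<close> in the library.\<close>

definition system_mat :: "nat \<Rightarrow> (nat \<Rightarrow> complex) \<Rightarrow> nat \<Rightarrow> complex mat" where
  "system_mat n \<xi> k =
    mat (n - k) (n - k) (\<lambda>(i, j). if j \<le> i then w_coef n \<xi> k (i + 1) (j + 1) else 0)"

definition system_rhs :: "bipoly \<Rightarrow> nat \<Rightarrow> (nat \<Rightarrow> complex) \<Rightarrow> nat \<Rightarrow> bipoly \<Rightarrow> complex vec" where
  "system_rhs p n \<xi> k r = vec (n - k) (\<lambda>i. poly (g_poly p n \<xi> k r) (\<xi> (i + 1)))"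

text \<open>
  The effect of one pass through the loop, given the solution \<open>v\<close> of the linear system, whose
  entries become the new \<open>\<beta>\<close> with indices \<open>i, k\<close> for \<open>k \<le> i < n\<close>.
\<close>

definition update_state ::
  "bipoly \<Rightarrow> nat \<Rightarrow> (nat \<Rightarrow> complex) \<Rightarrow> nat \<Rightarrow> complex vec \<Rightarrow> alg_state \<Rightarrow> alg_state" where
  "update_state p n \<xi> k v st =
    (let \<alpha> = (alpha st)(k := alpha_val p n k (res st));
         \<beta> = (\<lambda>i j. if j = k \<and> k \<le> i \<and> i < n then v $ (i - k) else beta st i j);
         q1 = (qs st)(k := qs st k + lin 1 (\<beta> k k) * qs st 0);
         q2 = fold (\<lambda>j q. q(j := lin 1 (- \<xi> j) * q (j - 1)
                                  + (\<Sum>l=2..k. lin 1 (\<beta> j l) * q (j - l))))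
                [k + 1..<n - 1] q1;
         q = q2(n - 1 := lin 1 (- \<xi> (n - 1)) * q2 (n - 2)
                          + (\<Sum>l=2..k. lin (\<alpha> l) (\<beta> (n - 1) l) * q2 (n - 1 - l)));
         s = p - bconst (bcoeff p n 0) * varx * q (n - 1)
               - (\<Sum>l=2..k - 1. bconst (gamma st (n - l)) * q (n - l));
         c = (-1) ^ (n - k) * bcoeff s 0 (n - k) / (\<Prod>i=1..n - k. \<xi> i)
     in \<lparr> qs = q,
          res = s - bconst c * q (n - k),
          alpha = \<alpha>,
          beta = \<beta>,
          gamma = (gamma st)(n - k := c) \<rparr>)"

text \<open>
  The algorithm is modelled as a relation, so that its ability to solve the linear systems is not
  built into the definition: without a solution there is no run, and each solution gives its own run.
\<close>

definition step ::
  "bipoly \<Rightarrow> nat \<Rightarrow> (nat \<Rightarrow> complex) \<Rightarrow> nat \<Rightarrow> alg_state \<Rightarrow> alg_state \<Rightarrow> bool" where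
  "step p n \<xi> k st st' \<longleftrightarrow>
    (\<exists>v \<in> carrier_vec (n - k).
       system_mat n \<xi> k *\<^sub>v v = system_rhs p n \<xi> k (res st) \<and>
       st' = update_state p n \<xi> k v st)"

fun loop ::
  "bipoly \<Rightarrow> nat \<Rightarrow> (nat \<Rightarrow> complex) \<Rightarrow> nat list \<Rightarrow> alg_state \<Rightarrow> alg_state \<Rightarrow> bool" where
  "loop p n \<xi> [] st st' \<longleftrightarrow> st' = st"
| "loop p n \<xi> (k # ks) st st' \<longleftrightarrow> (\<exists>st1. step p n \<xi> k st st1 \<and> loop p n \<xi> ks st1 st')"

text \<open>
  For \<open>n = 1\<close> the first and the last entry of the first row coincide; the entry displayed last is
  then the one that counts.
\<close>

definition out_A :: "nat \<Rightarrow> alg_state \<Rightarrow> complex mat" where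
  "out_A n st = mat n n (\<lambda>(i, j).
     if i = 0 then
       (if j = n - 1 then 0
        else if j = 0 then bcoeff (res st) 0 0
        else gamma st j)
     else if i = j then 1 else 0)"

definition out_B :: "bipoly \<Rightarrow> nat \<Rightarrow> alg_state \<Rightarrow> complex mat" where
  "out_B p n st = mat n n (\<lambda>(i, j).
     if i = 0 then
       (if j = n - 1 then bcoeff p n 0
        else if j = 0 then bcoeff (res st) 1 0
        else 0)
     else if j < i then
       (if i = n - 1 \<and> j < n - 2 then - alpha st (n - 1 - j) else - 1)
     else 0)"

definition out_C :: "nat \<Rightarrow> alg_state \<Rightarrow> complex mat" where
  "out_C n st = mat n n (\<lambda>(i, j). if j < i then - beta st i (i - j) else 0)"

definition alg_output ::
  "bipoly \<Rightarrow> nat \<Rightarrow> (nat \<Rightarrow> complex) \<Rightarrow> complex mat \<times> complex mat \<times> complex mat \<Rightarrow> bool" where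
  "alg_output p n \<xi> M \<longleftrightarrow>
    (\<exists>st. loop p n \<xi> [2..<n] (init_state p n \<xi>) st \<and> M = (out_A n st, out_B p n st, out_C n st))"

end

theory Submission
  imports Defs "HOL-Computational_Algebra.Fundamental_Theorem_Algebra"
begin

text \<open>
  The rows of \<open>A + x B + y C\<close> below the first one encode a recurrence expressing \<open>q j\<close> by
  \<open>q (j - 1), \<dots>, q 0 = 1\<close>, so they annihilate the vector \<open>(q 0, \<dots>, q (n - 1))\<close>; hence the determinant
  is the first row times this vector.  It remains to see that the residual \<open>r\<close> loses one degree in
  each pass.  The new terms of pass \<open>k\<close> change \<open>q (n - 1)\<close> only in degrees up to \<open>n - k\<close>, and
  in degree \<open>n - k\<close> by a combination of products of the \<open>x - \<xi> i * y\<close>.  The choice of \<open>\<alpha>\<close> and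
  interpolation at the distinct points \<open>\<xi> 1, \<dots>, \<xi> (n - k)\<close>, which gives the triangular system,
  make this combination cancel the top part of \<open>r\<close>.  This is possible as long as the top part of
  \<open>r\<close> is divisible by \<open>x\<close>, and subtracting \<open>\<gamma> * q (n - k)\<close>, whose pure power of \<open>y\<close> does not
  vanish because the \<open>\<xi> i\<close> are nonzero, restores this divisibility.
\<close>

section \<open>Homogeneous parts of bivariate polynomials\<close>

text \<open>
  The homogeneous part of degree \<open>d\<close>, dehomogenised by \<open>x = t\<close>, \<open>y = 1\<close>.
\<close>

definition hom_part :: "nat \<Rightarrow> bipoly \<Rightarrow> complex poly" where
  "hom_part d f = (\<Sum>i\<le>d. monom (bcoeff f i (d - i)) i)"

lemma coeff_hom_part: "coeff (hom_part d f) i = (if i \<le> d then bcoeff f i (d - i) else 0)"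
  by (auto simp: hom_part_def coeff_sum)

lemma bcoeff_eq_hom_part: "bcoeff f i j = coeff (hom_part (i + j) f) i"
  by (simp add: coeff_hom_part)

lemma bcoeff_simps [simp]:
  "bcoeff 0 i j = 0"
  "bcoeff (f + g) i j = bcoeff f i j + bcoeff g i j"
  "bcoeff (f - g) i j = bcoeff f i j - bcoeff g i j"
  "bcoeff (bconst c * f) i j = c * bcoeff f i j"
  by (simp_all add: bcoeff_def bconst_def)

lemma bcoeff_one: "bcoeff 1 i j = (if i = 0 \<and> j = 0 then 1 else 0)"
  by (auto simp: bcoeff_def coeff_1 split: nat.splits)

lemma bcoeff_varx_mult: "bcoeff (varx * f) i j = (case i of 0 \<Rightarrow> 0 | Suc i' \<Rightarrow> bcoeff f i' j)"
  by (simp add: bcoeff_def varx_def coeff_pCons split: nat.splits)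

lemma bcoeff_vary_mult: "bcoeff (vary * f) i j = (case j of 0 \<Rightarrow> 0 | Suc j' \<Rightarrow> bcoeff f i j')"
  by (simp add: bcoeff_def vary_def coeff_pCons split: nat.splits)

lemma bcoeff_lin_mult:
  "bcoeff (lin a b * f) i j = a * (case i of 0 \<Rightarrow> 0 | Suc i' \<Rightarrow> bcoeff f i' j)
     + b * (case j of 0 \<Rightarrow> 0 | Suc j' \<Rightarrow> bcoeff f i j')"
  by (simp add: lin_def distrib_right mult.assoc bcoeff_varx_mult bcoeff_vary_mult)

lemma bipoly_eqI: "f = g" if "\<And>i j. bcoeff f i j = bcoeff g i j"
  using that by (auto simp: bcoeff_def poly_eq_iff)

lemma hom_part_simps [simp]:
  "hom_part d 0 = 0"
  "hom_part d (f + g) = hom_part d f + hom_part d g"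
  "hom_part d (f - g) = hom_part d f - hom_part d g"
  "hom_part d (bconst c * f) = smult c (hom_part d f)"
  by (auto simp: poly_eq_iff coeff_hom_part)

lemma hom_part_sum [simp]: "hom_part d (\<Sum>i\<in>I. f i) = (\<Sum>i\<in>I. hom_part d (f i))"
  by (induction I rule: infinite_finite_induct) auto

lemma hom_part_one: "hom_part d 1 = (if d = 0 then 1 else 0)"
  by (auto simp: poly_eq_iff coeff_hom_part bcoeff_one)

lemma hom_part_lin_mult:
  "hom_part (Suc d) (lin a b * f) = [:b, a:] * hom_part d f"
  by (auto simp: poly_eq_iff coeff_hom_part bcoeff_lin_mult coeff_pCons Suc_diff_le split: nat.splits)

lemma hom_part_varx_mult: "hom_part (Suc d) (varx * f) = pCons 0 (hom_part d f)"
  by (auto simp: poly_eq_iff coeff_hom_part bcoeff_varx_mult coeff_pCons split: nat.splits)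

lemma bcoeff_eq_0_of_total_degree:
  assumes "total_degree f < i + j"
  shows "bcoeff f i j = 0"
proof (rule ccontr)
  assume nz: "bcoeff f i j \<noteq> 0"
  define S where "S = {i + j | i j. bcoeff f i j \<noteq> 0}"
  \<comment> \<open>\<open>Max\<close> bounds the elements only of a finite set; finiteness holds
    because \<open>f\<close> has finitely many nonzero coefficients.\<close>
  have "S \<subseteq> (\<lambda>(i, j). i + j) ` (\<Union>j\<le>degree f. {..degree (coeff f j)} \<times> {j})"
    unfolding S_def bcoeff_def by (fastforce intro: le_degree)
  then have "finite S" by (rule finite_subset) auto
  moreover have "i + j \<in> S" using nz by (auto simp: S_def)
  ultimately have "i + j \<le> Max (insert 0 S)" by simp
  with assms show False by (simp add: total_degree_def S_def)
qed

section \<open>Sequences defined by linear forms\<close>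

text \<open>The rows of the returned pencil below the first, cut off after \<open>k\<close>
  subdiagonals. Pass \<open>k\<close> fills in subdiagonal \<open>k\<close>, so \<open>k\<close>
  tracks the progress of the loop; for \<open>k \<ge> N\<close> nothing is cut off.\<close>

definition lin_recurrence ::
  "(nat \<Rightarrow> nat \<Rightarrow> complex) \<Rightarrow> (nat \<Rightarrow> nat \<Rightarrow> complex) \<Rightarrow> nat \<Rightarrow> nat \<Rightarrow> (nat \<Rightarrow> bipoly) \<Rightarrow> bool" where
  "lin_recurrence a b N k q \<longleftrightarrow> q 0 = 1 \<and>
     (\<forall>j\<in>{1..N}. q j = (\<Sum>l=1..min k j. lin (a j l) (b j l) * q (j - l)))"

text \<open>By induction, a term with \<open>l \<ge> 2\<close> has degree at most
  \<open>j - l + 1 < j\<close>, so only \<open>l = 1\<close> reaches the top degree, where it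
  contributes one factor \<open>x - \<xi> j * y\<close>.\<close>

lemma hom_part_lin_recurrence:
  assumes "lin_recurrence a b N k q" "k \<ge> 1" "j \<le> N"
    and ab: "\<And>j. j \<in> {1..N} \<Longrightarrow> a j 1 = 1 \<and> b j 1 = - \<xi> j"
  shows "hom_part j (q j) = (\<Prod>i=1..j. [:- \<xi> i, 1:]) \<and> (\<forall>d>j. hom_part d (q j) = 0)"
  using \<open>j \<le> N\<close>
proof (induction j rule: less_induct)
  case (less j)
  show ?case
  proof (cases j)
    case 0
    with assms show ?thesis by (auto simp: lin_recurrence_def hom_part_one)
  next
    case (Suc j')
    have "q j = (\<Sum>l=1..min k j. lin (a j l) (b j l) * q (j - l))"
      using assms less.prems Suc by (auto simp: lin_recurrence_def)
    also have "{1..min k j} = insert 1 {2..min k j}"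
      using Suc \<open>k \<ge> 1\<close> by auto
    finally have q: "q j = lin 1 (- \<xi> j) * q j' + (\<Sum>l=2..min k j. lin (a j l) (b j l) * q (j - l))"
      using ab[of j] less.prems Suc by simp
    have "hom_part d' (q (j - l)) = 0" if "d' \<ge> j'" "l \<in> {2..min k j}" for d' l
      using less.IH[of "j - l"] that less.prems Suc by auto
    then have top: "hom_part (Suc d') (q j) = [:- \<xi> j, 1:] * hom_part d' (q j')" if "d' \<ge> j'" for d'
      using that by (subst q) (simp add: hom_part_lin_mult)
    note IH = less.IH[of j']
    have "hom_part d (q j) = 0" if "d > j" for d
      using top[of "d - 1"] IH less.prems Suc that by (cases d) auto
    moreover have "hom_part j (q j) = (\<Prod>i=1..j. [:- \<xi> i, 1:])"
      using top[of j'] IH less.prems unfolding Suc by (simp add: mult.commute)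
    ultimately show ?thesis by blast
  qed
qed

text \<open>Below index \<open>k\<close> neither cut-off is active, so both sequences are determined
  by the same recurrence.\<close>

lemma lin_recurrence_agree:
  assumes "lin_recurrence a b N (k - 1) q" "lin_recurrence a b N k q'" "j \<le> N" "j < k"
  shows "q' j = q j"
  using \<open>j \<le> N\<close> \<open>j < k\<close>
proof (induction j rule: less_induct)
  case (less j)
  show ?case
  proof (cases "j = 0")
    case True
    with assms show ?thesis by (auto simp: lin_recurrence_def)
  next
    case False
    then have "q' j = (\<Sum>l=1..j. lin (a j l) (b j l) * q' (j - l))"
      using assms less.prems by (auto simp: lin_recurrence_def min_def)
    also have "\<dots> = (\<Sum>l=1..j. lin (a j l) (b j l) * q (j - l))"
      using less by (intro sum.cong) auto
    also have "\<dots> = q j"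
    proof -
      have "min (k - 1) j = j" using less.prems by auto
      moreover have "q j = (\<Sum>l=1..min (k - 1) j. lin (a j l) (b j l) * q (j - l))"
        using assms(1) less.prems False unfolding lin_recurrence_def by simp
      ultimately show ?thesis by simp
    qed
    finally show ?thesis .
  qed
qed

text \<open>
  In top degree, only the factors \<open>x - \<xi> j * y\<close> propagate the change caused by the new terms \<open>l = k\<close>.
\<close>

lemma hom_part_lin_recurrence_diff:
  assumes "lin_recurrence a b N (k - 1) q" "lin_recurrence a b N k q'" "k \<ge> 2" "j \<le> N"
    and ab: "\<And>j. j \<in> {1..N} \<Longrightarrow> a j 1 = 1 \<and> b j 1 = - \<xi> j"
  shows "(\<forall>d. d + k > j + 1 \<longrightarrow> hom_part d (q' j - q j) = 0) \<and>
    (j + 1 \<ge> k \<longrightarrow> hom_part (j + 1 - k) (q' j - q j) =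
      (\<Sum>l=k..j. [:b l k, a l k:] * (\<Prod>i=1..l - k. [:- \<xi> i, 1:]) * (\<Prod>i=l + 1..j. [:- \<xi> i, 1:])))"
    (is "?P j")
  using \<open>j \<le> N\<close>
proof (induction j rule: less_induct)
  case (less j)
  define S where "S j =
      (\<Sum>l=k..j. [:b l k, a l k:] * (\<Prod>i=1..l - k. [:- \<xi> i, 1:]) * (\<Prod>i=l + 1..j. [:- \<xi> i, 1:]))" for j
  show ?case
  proof (cases "j < k")
    case True
    then show ?thesis
      using lin_recurrence_agree[OF assms(1,2)] less.prems by simp
  next
    case False
    then have j: "j \<ge> k" "j \<ge> 2" using \<open>k \<ge> 2\<close> by auto
    let ?D = "\<lambda>j. q' j - q j"
    have "q j = (\<Sum>l=1..k - 1. lin (a j l) (b j l) * q (j - l))"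
      using assms(1) j less.prems by (auto simp: lin_recurrence_def min_def)
    moreover have "q' j = (\<Sum>l=1..k. lin (a j l) (b j l) * q' (j - l))"
      using assms(2) j less.prems by (auto simp: lin_recurrence_def min_def)
    then have "q' j = (\<Sum>l=1..k - 1. lin (a j l) (b j l) * q' (j - l)) + lin (a j k) (b j k) * q' (j - k)"
      using \<open>k \<ge> 2\<close> by (cases k) auto
    \<comment> \<open>The difference obeys the old recurrence, with the single new term as an
      inhomogeneity.\<close>
    ultimately have "?D j = (\<Sum>l=1..k - 1. lin (a j l) (b j l) * ?D (j - l)) + lin (a j k) (b j k) * q' (j - k)"
      by (simp add: right_diff_distrib sum_subtractf)
    also have "{1..k - 1} = insert 1 {2..k - 1}"
      using \<open>k \<ge> 2\<close> by auto
    finally have D: "?D j = lin 1 (- \<xi> j) * ?D (j - 1) + (\<Sum>l=2..k - 1. lin (a j l) (b j l) * ?D (j - l))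
        + lin (a j k) (b j k) * q' (j - k)"
      using ab[of j] less.prems j by simp
    have IH: "hom_part d (?D i) = 0" if "i < j" "d + k > i + 1" for i d
      using less.IH[of i] that less.prems by (meson less_imp_le order_trans)
    have IH_top: "hom_part (i + 1 - k) (?D i) = S i" if "i < j" "i + 1 \<ge> k" for i
      unfolding S_def using less.IH[of i] that less.prems by (meson less_imp_le order_trans)
    \<comment> \<open>For \<open>l \<ge> 2\<close> the change of \<open>q (j - l)\<close> lives in
      degrees below \<open>j - k\<close>, so these terms do not reach degree
      \<open>j + 1 - k\<close>.\<close>
    have 0: "hom_part d (?D (j - l)) = 0" if "d \<ge> j - k" "l \<in> {2..k - 1}" for d l
      using that j by (intro IH) auto
    have step: "hom_part (Suc d) (?D j) = [:- \<xi> j, 1:] * hom_part d (?D (j - 1))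
        + [:b j k, a j k:] * hom_part d (q' (j - k))" if "d \<ge> j - k" for d
    proof -
      have "(\<Sum>l=2..k - 1. hom_part (Suc d) (lin (a j l) (b j l) * ?D (j - l))) = 0"
        using 0[OF that] by (intro sum.neutral) (simp only: hom_part_lin_mult mult_zero_right, simp)
      then show ?thesis
        by (subst D) (simp only: hom_part_simps hom_part_sum hom_part_lin_mult, simp)
    qed
    have top: "hom_part (j - k) (q' (j - k)) = (\<Prod>i=1..j - k. [:- \<xi> i, 1:])"
      "d > j - k \<Longrightarrow> hom_part d (q' (j - k)) = 0" for d
      using hom_part_lin_recurrence[OF assms(2), of "j - k"] ab \<open>k \<ge> 2\<close> less.prems by auto
    have "hom_part d (?D j) = 0" if "d + k > j + 1" for d
    proof -
      have d: "d - 1 > j - k" "d = Suc (d - 1)" using that j by auto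
      have "hom_part (d - 1) (?D (j - 1)) = 0" using that j by (intro IH) auto
      then show ?thesis
        using step[of "d - 1"] top(2)[of "d - 1"] d by simp
    qed
    moreover have "hom_part (j + 1 - k) (?D j) = S j"
    proof -
      have "hom_part (j - k) (?D (j - 1)) = S (j - 1)"
        using IH_top[of "j - 1"] j by simp
      \<comment> \<open>The summand \<open>l = j\<close> is new and has an empty second product; in
        all others that product gains the factor for index \<open>j\<close>.\<close>
      moreover have "S j = [:- \<xi> j, 1:] * S (j - 1) + [:b j k, a j k:] * (\<Prod>i=1..j - k. [:- \<xi> i, 1:])"
      proof -
        obtain j' where j': "j = Suc j'" using j by (cases j) auto
        have "S j = (\<Sum>l=k..j'. [:b l k, a l k:] * (\<Prod>i=1..l - k. [:- \<xi> i, 1:]) * (\<Prod>i=l + 1..j. [:- \<xi> i, 1:]))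
            + [:b j k, a j k:] * (\<Prod>i=1..j - k. [:- \<xi> i, 1:])"
          using j by (simp add: S_def j' del: mult_pCons_left)
        also have "(\<Sum>l=k..j'. [:b l k, a l k:] * (\<Prod>i=1..l - k. [:- \<xi> i, 1:]) * (\<Prod>i=l + 1..j. [:- \<xi> i, 1:]))
          = [:- \<xi> j, 1:] * S j'"
          unfolding S_def sum_distrib_left j'
          by (intro sum.cong refl) (simp add: prod.nat_ivl_Suc' algebra_simps del: mult_pCons_left mult_pCons_right)
        finally show ?thesis by (simp add: j')
      qed
      ultimately show ?thesis
        using step[of "j - k"] top(1) j by (simp add: Suc_diff_le)
    qed
    ultimately show ?thesis by (simp add: S_def)
  qed
qed

section \<open>Interpolation\<close>

lemma monic_prod_linear:
  fixes f :: "'b \<Rightarrow> 'a :: idom"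
  assumes "finite I"
  shows "degree (\<Prod>i\<in>I. [:- f i, 1:]) = card I" "coeff (\<Prod>i\<in>I. [:- f i, 1:]) (card I) = 1"
proof -
  show *: "degree (\<Prod>i\<in>I. [:- f i, 1:]) = card I"
    by (subst degree_prod_eq_sum_degree) auto
  show "coeff (\<Prod>i\<in>I. [:- f i, 1:]) (card I) = 1"
    using lead_coeff_prod[of "\<lambda>i. [:- f i, 1:]" I] * by simp
qed

text \<open>The indices \<open>l - k + 1\<close> to \<open>l\<close> are skipped: a new term in row
  \<open>l\<close> jumps from \<open>q (l - k)\<close> to \<open>q l\<close>, and this is its effect
  on \<open>q (n - 1)\<close> in top degree. For \<open>l \<ge> k\<close> the value at
  \<open>\<xi> m\<close> is \<open>w_coef n \<xi> k m (l - k + 1)\<close>.\<close>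

abbreviation basis_poly :: "nat \<Rightarrow> (nat \<Rightarrow> complex) \<Rightarrow> nat \<Rightarrow> nat \<Rightarrow> complex poly" where
  "basis_poly n \<xi> k l \<equiv> (\<Prod>i=1..l - k. [:- \<xi> i, 1:]) * (\<Prod>i=l + 1..n - 1. [:- \<xi> i, 1:])"

lemma monic_basis_poly:
  assumes "k \<le> l" "l < n"
  shows "degree (basis_poly n \<xi> k l) = n - 1 - k" "coeff (basis_poly n \<xi> k l) (n - 1 - k) = 1"
proof -
  let ?A = "\<Prod>i=1..l - k. [:- \<xi> i, 1:]" and ?B = "\<Prod>i=l + 1..n - 1. [:- \<xi> i, 1:]"
  have A: "degree ?A = l - k" "lead_coeff ?A = 1" and B: "degree ?B = n - 1 - l" "lead_coeff ?B = 1"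
    using monic_prod_linear[of "{1..l - k}" \<xi>] monic_prod_linear[of "{l + 1..n - 1}" \<xi>] by auto
  have AB: "?A \<noteq> 0" "?B \<noteq> 0" by auto
  show deg: "degree (?A * ?B) = n - 1 - k"
    using degree_mult_eq[OF AB] A B assms by auto
  show "coeff (?A * ?B) (n - 1 - k) = 1"
    using lead_coeff_mult[of ?A ?B] A B deg by simp
qed

text \<open>The basis polynomials are monic of a degree independent of \<open>l\<close>, which is
  why \<open>alpha_val\<close> only has to count them.\<close>

lemma coeff_pCons_basis_poly:
  assumes "k \<le> l" "l < n" "i \<ge> n - k"
  shows "coeff ([:0, 1:] * basis_poly n \<xi> k l) i = (if i = n - k then 1 else 0)"
proof (cases i)
  case 0
  with assms show ?thesis by auto
next
  case (Suc i')
  show ?thesis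
  proof (cases "i = n - k")
    case True
    then have "i' = n - 1 - k" using Suc assms by auto
    then have "coeff (basis_poly n \<xi> k l) i' = 1"
      by (simp only: monic_basis_poly(2)[OF assms(1,2)])
    then have "coeff ([:0, 1:] * basis_poly n \<xi> k l) (Suc i') = 1"
      by simp
    then show ?thesis
      unfolding Suc[symmetric] if_P[OF True] .
  next
    case False
    then have "i' > degree (basis_poly n \<xi> k l)"
      unfolding monic_basis_poly(1)[OF assms(1,2)] using Suc assms by auto
    from coeff_eq_0[OF this] False Suc show ?thesis by simp
  qed
qed

lemma coeff_h_poly:
  "coeff (h_poly p n k r) i = (if i \<le> n - k then bcoeff r (i + 1) (n - k - i) / bcoeff p n 0 else 0)"
proof -
  define m where "m = n - k"
  have "coeff (\<Sum>i\<le>m. monom (bcoeff r (m + 1 - i) i) (m - i)) i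
     = (\<Sum>j\<le>m. if j = m - i then if i \<le> m then bcoeff r (i + 1) (m - i) else 0 else 0)"
    unfolding coeff_sum by (intro sum.cong refl) (auto simp: Suc_diff_le)
  then show ?thesis by (simp add: h_poly_def m_def)
qed

text \<open>The choice of \<open>\<alpha>\<close> cancels the coefficient of \<open>t ^ (n - k)\<close>.\<close>

lemma degree_g_poly:
  assumes "2 \<le> k" "k < n"
  shows "degree (g_poly p n \<xi> k r) < n - k"
proof (rule degree_lessI)
  show "g_poly p n \<xi> k r \<noteq> 0 \<or> 0 < n - k" using assms by auto
next
  show "\<forall>i\<ge>n - k. coeff (g_poly p n \<xi> k r) i = 0"
  proof (intro allI impI)
    fix i assume i: "i \<ge> n - k"
    have *: "coeff ([:0, 1:] * basis_poly n \<xi> k l) i = (if i = n - k then 1 else 0)" if "l \<in> {k..n - 1}" for l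
      by (rule coeff_pCons_basis_poly) (use that i assms in auto)
    \<comment> \<open>The \<open>\<alpha>\<close> term of \<open>g\<close> is the missing summand
      \<open>l = n - 1\<close>, whose second product is empty.\<close>
    have "g_poly p n \<xi> k r = h_poly p n k r - (\<Sum>l=k..n - 2. [:0, 1:] * basis_poly n \<xi> k l)
       - smult (alpha_val p n k r) ([:0, 1:] * basis_poly n \<xi> k (n - 1))"
      using assms by (simp add: g_poly_def sum_distrib_left diff_right_commute del: mult_pCons_left)
    moreover have "(\<Sum>l=k..n - 2. coeff ([:0, 1:] * basis_poly n \<xi> k l) i) = (\<Sum>l=k..n - 2. if i = n - k then 1 else 0)"
      by (intro sum.cong refl *) auto
    ultimately have "coeff (g_poly p n \<xi> k r) i = coeff (h_poly p n k r) i
      - (\<Sum>l=k..n - 2. if i = n - k then 1 else 0) - alpha_val p n k r * (if i = n - k then 1 else 0)"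
      using *[of "n - 1"] assms by (simp only: coeff_diff coeff_sum coeff_smult) simp
    \<comment> \<open>At \<open>i = n - k\<close> the sum consists of \<open>n - 1 - k\<close> ones,
      matching the integer \<open>- n + k + 1\<close> in \<open>alpha_val\<close>.\<close>
    then show "coeff (g_poly p n \<xi> k r) i = 0"
      using i assms by (auto simp: coeff_h_poly alpha_val_def of_nat_diff Suc_diff_le)
  qed
qed

lemma poly_basis_poly: "poly (basis_poly n \<xi> k l) z = (\<Prod>i=1..l - k. z - \<xi> i) * (\<Prod>i=l + 1..n - 1. z - \<xi> i)"
  by (simp add: poly_prod)

text \<open>Both \<open>g\<close> and the combination of basis polynomials with coefficients from
  \<open>v\<close> have degree below \<open>n - k\<close>, and the system says that they agree at
  \<open>n - k\<close> distinct points, so they are equal. Moving the subtracted multiples of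
  \<open>t\<close> back turns the coefficients into linear forms, the shape in which
  \<open>hom_part_lin_recurrence_diff\<close> gives the change of \<open>q (n - 1)\<close>.\<close>

lemma h_poly_interpolation:
  assumes k: "2 \<le> k" "k < n" and inj: "inj_on \<xi> {1..n - 1}" and v: "v \<in> carrier_vec (n - k)"
    and sys: "system_mat n \<xi> k *\<^sub>v v = system_rhs p n \<xi> k r"
  shows "h_poly p n k r =
    (\<Sum>l=k..n - 1. [:v $ (l - k), if l = n - 1 then alpha_val p n k r else 1:] * basis_poly n \<xi> k l)"
proof -
  define G where "G = (\<Sum>l=k..n - 1. smult (v $ (l - k)) (basis_poly n \<xi> k l))"
  have "g_poly p n \<xi> k r = G"
  proof (rule poly_eqI_degree)
    have "card (\<xi> ` {1..n - k}) = n - k"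
      using k by (subst card_image[OF inj_on_subset[OF inj]]) auto
    then show "degree (g_poly p n \<xi> k r) < card (\<xi> ` {1..n - k})"
      "degree G < card (\<xi> ` {1..n - k})"
      using degree_g_poly k monic_basis_poly(1)[of k _ n \<xi>]
      by (auto simp: G_def intro!: degree_sum_less le_less_trans[OF degree_smult_le])
  next
    fix z assume "z \<in> \<xi> ` {1..n - k}"
    then obtain i where i: "i < n - k" "z = \<xi> (i + 1)"
      by (auto simp: image_iff) (metis Suc_le_eq Suc_pred le_eq_less_or_eq less_Suc_eq_le)
    have "poly (g_poly p n \<xi> k r) z = system_rhs p n \<xi> k r $ i"
      using i by (simp add: system_rhs_def)
    also have "\<dots> = (\<Sum>j = 0..<n - k. (if j \<le> i then w_coef n \<xi> k (i + 1) (j + 1) else 0) * v $ j)"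
      using i v unfolding sys[symmetric] by (auto simp: system_mat_def scalar_prod_def)
    also have "\<dots> = (\<Sum>l=k..n - 1. v $ (l - k) * poly (basis_poly n \<xi> k l) z)"
    proof (intro sum.reindex_bij_witness[of _ "\<lambda>l. l - k" "\<lambda>j. j + k"])
      fix j assume j: "j \<in> {0..<n - k}"
      have "poly (basis_poly n \<xi> k (j + k)) z = w_coef n \<xi> k (i + 1) (j + 1)"
        unfolding poly_basis_poly by (simp add: w_coef_def i)
      \<comment> \<open>Above the diagonal the first product contains
        \<open>\<xi> (i + 1) - \<xi> (i + 1)\<close>, so the zeros of the triangular matrix are true
        values of the basis polynomials.\<close>
      moreover have "w_coef n \<xi> k (i + 1) (j + 1) = 0" if "\<not> j \<le> i"
        using that by (auto simp: w_coef_def intro!: bexI[of _ "i + 1"])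
      ultimately show "v $ (j + k - k) * poly (basis_poly n \<xi> k (j + k)) z =
        (if j \<le> i then w_coef n \<xi> k (i + 1) (j + 1) else 0) * v $ j"
        by auto
    qed (use k in auto)
    also have "\<dots> = poly G z"
      by (simp add: G_def poly_sum)
    finally show "poly (g_poly p n \<xi> k r) z = poly G z" .
  qed
  then have "h_poly p n k r = G + (\<Sum>l=k..n - 2. [:0, 1:] * basis_poly n \<xi> k l)
       + smult (alpha_val p n k r) ([:0, 1:] * basis_poly n \<xi> k (n - 1))"
    using k by (simp add: g_poly_def sum_distrib_left diff_right_commute algebra_simps del: mult_pCons_left)
  also have "\<dots> = (\<Sum>l=k..n - 1. smult (v $ (l - k)) (basis_poly n \<xi> k l)
      + smult (if l = n - 1 then alpha_val p n k r else 1) ([:0, 1:] * basis_poly n \<xi> k l))"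
  proof -
    obtain m where m: "n = Suc (Suc m)" using k by (intro that[of "n - 2"]) auto
    have "(\<Sum>l=k..m. smult (if l = Suc m then alpha_val p n k r else 1) ([:0, 1:] * basis_poly n \<xi> k l))
      = (\<Sum>l=k..m. [:0, 1:] * basis_poly n \<xi> k l)"
      by (intro sum.cong refl) simp
    then show ?thesis
      using k by (simp add: G_def sum.distrib m del: mult_pCons_left)
  qed
  also have "\<dots> = (\<Sum>l=k..n - 1. [:v $ (l - k), if l = n - 1 then alpha_val p n k r else 1:] * basis_poly n \<xi> k l)"
    by (intro sum.cong refl) simp
  finally show ?thesis .
qed

section \<open>Roots, determinants and recursive updates\<close>

lemma coeff_lead_poly:
  "coeff (lead_poly p n) m = (if m < n then bcoeff p (m + 1) (n - 1 - m) else 0)"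
proof -
  have "coeff (lead_poly p n) m = (\<Sum>i<n. if i = n - 1 - m then if m < n then bcoeff p (m + 1) (n - 1 - m) else 0 else 0)"
    unfolding lead_poly_def coeff_sum by (intro sum.cong refl) (auto simp: Suc_diff_Suc)
  then show ?thesis by auto
qed

lemma degree_lead_poly:
  assumes "n > 0" "bcoeff p n 0 \<noteq> 0"
  shows "degree (lead_poly p n) = n - 1" "lead_coeff (lead_poly p n) = bcoeff p n 0"
proof -
  show *: "degree (lead_poly p n) = n - 1"
    using assms by (intro antisym degree_le le_degree) (auto simp: coeff_lead_poly)
  show "lead_coeff (lead_poly p n) = bcoeff p n 0"
    unfolding * using assms by (simp add: coeff_lead_poly)
qed

lemma lead_poly_decompose:
  assumes "n > 0" "bcoeff p n 0 \<noteq> 0"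
    and "\<And>z. poly (lead_poly p n) z = 0 \<Longrightarrow> order z (lead_poly p n) = 1"
  shows "lead_poly p n = smult (bcoeff p n 0) (\<Prod>z | poly (lead_poly p n) z = 0. [:- z, 1:])"
proof -
  have "lead_poly p n = smult (bcoeff p n 0) (\<Prod>z | poly (lead_poly p n) z = 0. [:- z, 1:] ^ order z (lead_poly p n))"
    using complex_poly_decompose[of "lead_poly p n"] degree_lead_poly[OF assms(1,2)] by simp
  also have "(\<Prod>z | poly (lead_poly p n) z = 0. [:- z, 1:] ^ order z (lead_poly p n)) =
      (\<Prod>z | poly (lead_poly p n) z = 0. [:- z, 1:])"
    using assms(3) by (intro prod.cong refl) auto
  finally show ?thesis .
qed

text \<open>Exactly \<open>n - 1\<close> distinct roots are needed; comparing degrees in the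
  factorisation into distinct linear factors gives this number.\<close>

lemma root_enumeration_exists:
  assumes "n > 0" "bcoeff p n 0 \<noteq> 0"
    and "\<And>z. poly (lead_poly p n) z = 0 \<Longrightarrow> order z (lead_poly p n) = 1"
  shows "\<exists>\<xi>. root_enumeration p n \<xi>"
proof -
  let ?R = "{z. poly (lead_poly p n) z = 0}"
  have "lead_poly p n \<noteq> 0"
    using degree_lead_poly[OF assms(1,2)] assms(2) by auto
  then have fin: "finite ?R" by (rule poly_roots_finite)
  have "n - 1 = degree (smult (bcoeff p n 0) (\<Prod>z\<in>?R. [:- z, 1:]))"
    using lead_poly_decompose[OF assms] degree_lead_poly(1)[OF assms(1,2)] by simp
  also have "\<dots> = card ?R"
    using assms(2) by (simp add: degree_prod_eq_sum_degree)
  finally show ?thesis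
    using ex_bij_betw_nat_finite_1[OF fin] by (simp add: root_enumeration_def)
qed

lemma lead_poly_root_enumeration:
  assumes "n > 0" "bcoeff p n 0 \<noteq> 0"
    and "\<And>z. poly (lead_poly p n) z = 0 \<Longrightarrow> order z (lead_poly p n) = 1"
    and "root_enumeration p n \<xi>"
  shows "lead_poly p n = smult (bcoeff p n 0) (\<Prod>i=1..n - 1. [:- \<xi> i, 1:])"
  using lead_poly_decompose[OF assms(1-3)]
    prod.reindex_bij_betw[OF assms(4)[unfolded root_enumeration_def], of "\<lambda>z. [:- z, 1:]"]
  by simp

section \<open>Solvability of the linear systems and evaluation of the determinant\<close>

lemma ex1_mult_mat_vec:
  fixes A :: "'a :: field mat"
  assumes A: "A \<in> carrier_mat n n" "det A \<noteq> 0" and b: "b \<in> carrier_vec n"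
  shows "\<exists>!v. v \<in> carrier_vec n \<and> A *\<^sub>v v = b"
proof -
  from det_non_zero_imp_unit[OF A] obtain B where B: "B \<in> carrier_mat n n" "B * A = 1\<^sub>m n" "A * B = 1\<^sub>m n"
    by (auto simp: Units_def ring_mat_def)
  show ?thesis
  proof (intro ex1I[of _ "B *\<^sub>v b"] conjI)
    show "B *\<^sub>v b \<in> carrier_vec n" using B b by auto
    show "A *\<^sub>v (B *\<^sub>v b) = b"
      using assoc_mult_mat_vec[OF A(1) B(1) b] B(3) b by (metis one_mult_mat_vec)
  next
    fix v assume v: "v \<in> carrier_vec n \<and> A *\<^sub>v v = b"
    then have "B *\<^sub>v b = (B * A) *\<^sub>v v" using A B by (metis assoc_mult_mat_vec)
    then show "v = B *\<^sub>v b" using B v by simp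
  qed
qed

text \<open>The diagonal entry in row \<open>m\<close> omits the indices \<open>m\<close> to
  \<open>m + k - 1\<close>, so each of its factors is a difference of \<open>\<xi>\<close> at two
  distinct indices.\<close>

lemma det_system_mat:
  assumes "inj_on \<xi> {1..n - 1}" "2 \<le> k"
  shows "det (system_mat n \<xi> k) \<noteq> 0"
proof -
  have "det (system_mat n \<xi> k) = (\<Prod>i = 0..<n - k. w_coef n \<xi> k (i + 1) (i + 1))"
    by (subst det_lower_triangular[where n = "n - k"]) (auto simp: system_mat_def prod_list_diag_prod)
  moreover have "w_coef n \<xi> k (i + 1) (i + 1) \<noteq> 0" if "i < n - k" for i
  proof -
    have "\<xi> (i + 1) - \<xi> x \<noteq> 0" if "x \<in> {1..i} \<union> {i + 1 + k..n - 1}" for x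
    proof -
      have "x \<in> {1..n - 1}" "i + 1 \<in> {1..n - 1}" "x \<noteq> i + 1"
        using that \<open>i < n - k\<close> assms(2) by auto
      then show ?thesis using inj_on_eq_iff[OF assms(1), of "i + 1" x] by simp
    qed
    then show ?thesis by (simp add: w_coef_def)
  qed
  ultimately show ?thesis by simp
qed

text \<open>
  Replacing column \<open>0\<close> by \<open>M q\<close> does not change the determinant because \<open>q 0 = 1\<close>, and makes
  it \<open>M q\<close> a multiple of the first unit vector.
\<close>

lemma det_eq_first_row_sum:
  fixes M :: "'a :: comm_ring_1 mat"
  assumes M: "M \<in> carrier_mat n n" and n: "n > 0" and q0: "q 0 = 1"
    and upper: "\<And>i j. 0 < i \<Longrightarrow> i < j \<Longrightarrow> j < n \<Longrightarrow> M $$ (i, j) = 0"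
    and diag: "\<And>i. 0 < i \<Longrightarrow> i < n \<Longrightarrow> M $$ (i, i) = 1"
    and ker: "\<And>i. 0 < i \<Longrightarrow> i < n \<Longrightarrow> (\<Sum>j<n. M $$ (i, j) * q j) = 0"
  shows "det M = (\<Sum>j<n. M $$ (0, j) * q j)"
proof -
  \<comment> \<open>The identity with column \<open>0\<close> replaced by \<open>q\<close>; its
    determinant is \<open>1\<close> because \<open>q 0 = 1\<close>.\<close>
  define Q where "Q = mat n n (\<lambda>(i, j). if j = 0 then q i else if i = j then 1 else 0)"
  have Q: "Q \<in> carrier_mat n n" by (simp add: Q_def)
  have "det Q = (\<Prod>i = 0..<n. Q $$ (i, i))"
    by (subst det_lower_triangular[OF _ Q]) (auto simp: Q_def prod_list_diag_prod)
  also have "\<dots> = 1" by (intro prod.neutral) (auto simp: Q_def q0)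
  finally have "det M = det (M * Q)" using det_mult[OF M Q] by simp
  define N where "N = M * Q"
  have N: "N \<in> carrier_mat n n" using M Q by (simp add: N_def)
  have idx: "N $$ (i, j) = (\<Sum>l<n. M $$ (i, l) * Q $$ (l, j))" if "i < n" "j < n" for i j
    using that M Q by (auto simp: N_def scalar_prod_def lessThan_atLeast0 intro!: sum.cong)
  have col0: "N $$ (i, 0) = (\<Sum>l<n. M $$ (i, l) * q l)" if "i < n" for i
    using that n by (subst idx) (auto simp: Q_def)
  have col: "N $$ (i, j) = M $$ (i, j)" if "i < n" "j < n" "j \<noteq> 0" for i j
  proof -
    have "N $$ (i, j) = (\<Sum>l<n. if l = j then M $$ (i, l) else 0)"
      unfolding idx[OF that(1,2)] using that by (intro sum.cong refl) (auto simp: Q_def)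
    then show ?thesis using that by simp
  qed
  have D: "mat_delete N 0 0 \<in> carrier_mat (n - 1) (n - 1)"
    using N by (rule mat_delete_carrier)
  have D_idx: "mat_delete N 0 0 $$ (i, j) = M $$ (Suc i, Suc j)" if "i < n - 1" "j < n - 1" for i j
    using that carrier_matD[OF N] col[of "Suc i" "Suc j"] by (simp add: mat_delete_def)
  have "det (mat_delete N 0 0) = (\<Prod>i = 0..<n - 1. mat_delete N 0 0 $$ (i, i))"
    using D by (subst det_lower_triangular[OF _ D]) (auto simp: D_idx upper prod_list_diag_prod)
  also have "\<dots> = 1" by (intro prod.neutral) (auto simp: D_idx diag)
  finally have cof: "cofactor N 0 0 = 1" by (simp add: cofactor_def)
  \<comment> \<open>Column \<open>0\<close> of \<open>N\<close> vanishes below its first entry, and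
    the remaining minor is unit lower triangular.\<close>
  have "det N = (\<Sum>i<n. N $$ (i, 0) * cofactor N i 0)"
    by (rule laplace_expansion_column[OF N n])
  also have "\<dots> = (\<Sum>i<n. if i = 0 then N $$ (0, 0) else 0)"
    by (intro sum.cong refl) (auto simp: cof col0 ker)
  also have "\<dots> = (\<Sum>j<n. M $$ (0, j) * q j)" using n by (simp add: col0)
  finally show ?thesis using \<open>det M = det (M * Q)\<close> by (simp add: N_def)
qed

text \<open>\<open>F j\<close> reads only positions below \<open>j\<close>, which are not written
  again once \<open>j\<close> is reached. Hence the finished array satisfies the recursion with its
  own final values.\<close>

lemma fold_fun_upd_recursion:
  fixes F :: "nat \<Rightarrow> (nat \<Rightarrow> 'a) \<Rightarrow> 'a"
  assumes "\<And>j q q'. a \<le> j \<Longrightarrow> (\<And>i. i < j \<Longrightarrow> q i = q' i) \<Longrightarrow> F j q = F j q'"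
  shows "fold (\<lambda>j q. q(j := F j q)) [a..<b] q0 j =
    (if a \<le> j \<and> j < b then F j (fold (\<lambda>j q. q(j := F j q)) [a..<b] q0) else q0 j)"
proof (induction b arbitrary: j)
  case 0
  show ?case by simp
next
  case (Suc b)
  show ?case
  proof (cases "a \<le> b")
    case True
    define q where "q = fold (\<lambda>j q. q(j := F j q)) [a..<b] q0"
    have eq: "fold (\<lambda>j q. q(j := F j q)) [a..<Suc b] q0 = q(b := F b q)"
      using True by (simp add: q_def)
    have F: "F j (q(b := F b q)) = F j q" if "a \<le> j" "j \<le> b" for j
      using that by (intro assms) auto
    have IH: "q j = (if a \<le> j \<and> j < b then F j q else q0 j)"
      unfolding q_def by (rule Suc.IH)
    show ?thesis
    proof (cases "j = b")
      case False
      then have "(q(b := F b q)) j = (if a \<le> j \<and> j < b then F j q else q0 j)"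
        using IH by simp
      also have "\<dots> = (if a \<le> j \<and> j < Suc b then F j (q(b := F b q)) else q0 j)"
        using F[of j] False by (simp add: less_Suc_eq)
      finally show ?thesis unfolding eq .
    next
      case j: True
      show ?thesis unfolding eq j using F[of b] True by simp
    qed
  qed auto
qed

section \<open>The loop invariant\<close>

text \<open>Up to sign, the entries of \<open>B\<close> below the diagonal, indexed by row and
  subdiagonal. The guard \<open>2 \<le> l\<close> keeps the coefficient \<open>1\<close> on the
  first subdiagonal in the last row too.\<close>

definition alpha_coef :: "nat \<Rightarrow> alg_state \<Rightarrow> nat \<Rightarrow> nat \<Rightarrow> complex" where
  "alpha_coef n st j l = (if j = n - 1 \<and> 2 \<le> l then alpha st l else 1)"

text \<open>The situation after pass \<open>k\<close>, with \<open>k = 1\<close> for the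
  initialisation. The last conjunct makes the top form of the residual divisible by
  \<open>x\<close>, as the next pass demands.\<close>

definition alg_inv :: "bipoly \<Rightarrow> nat \<Rightarrow> (nat \<Rightarrow> complex) \<Rightarrow> nat \<Rightarrow> alg_state \<Rightarrow> bool" where
  "alg_inv p n \<xi> k st \<longleftrightarrow>
     lin_recurrence (alpha_coef n st) (beta st) (n - 1) k (qs st) \<and>
     (\<forall>j. beta st j 1 = - \<xi> j) \<and>
     res st = p - bconst (bcoeff p n 0) * varx * qs st (n - 1)
                - (\<Sum>l=2..k. bconst (gamma st (n - l)) * qs st (n - l)) \<and>
     (\<forall>d>n - k. hom_part d (res st) = 0) \<and>
     bcoeff (res st) 0 (n - k) = 0"

lemma hom_part_eq_0_of_total_degree: "hom_part d f = 0" if "total_degree f < d"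
  using that by (auto simp: poly_eq_iff coeff_hom_part bcoeff_eq_0_of_total_degree)

lemma hom_part_top:
  assumes "bcoeff p 0 n = 0"
  shows "hom_part n p = pCons 0 (lead_poly p n)"
  using assms by (auto simp: poly_eq_iff coeff_hom_part coeff_lead_poly coeff_pCons split: nat.splits)

lemma hom_part_const_varx_mult:
  "hom_part (Suc d) (bconst c * varx * f) = pCons 0 (smult c (hom_part d f))"
  by (simp add: mult.assoc hom_part_varx_mult)

lemma bcoeff_const_varx_mult: "bcoeff (bconst c * varx * f) 0 j = 0"
  by (simp add: mult.assoc bcoeff_varx_mult)

text \<open>A change of \<open>q (n - 1)\<close> acts on the residual only after multiplication by
  \<open>x\<close> and the leading coefficient. As the pure power of \<open>y\<close> is absent, the
  same factors split off here and leave \<open>h\<close>.\<close>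

lemma hom_part_h_poly:
  assumes "bcoeff r 0 (n - k + 1) = 0" "bcoeff p n 0 \<noteq> 0"
  shows "hom_part (Suc (n - k)) r = pCons 0 (smult (bcoeff p n 0) (h_poly p n k r))"
  using assms by (auto simp: poly_eq_iff coeff_hom_part coeff_h_poly coeff_pCons split: nat.splits)

text \<open>The factorisation of \<open>lead_poly\<close> makes the degree \<open>n\<close> parts of
  \<open>p\<close> and of the subtracted product equal. That product is divisible by
  \<open>x\<close>, so \<open>bcoeff p 0 (n - 1) = 0\<close> yields the last conjunct.\<close>

lemma alg_inv_init:
  assumes "total_degree p = n" "bcoeff p n 0 \<noteq> 0" "bcoeff p 0 n = 0" "bcoeff p 0 (n - 1) = 0" "n > 0"
    and lead: "lead_poly p n = smult (bcoeff p n 0) (\<Prod>i=1..n - 1. [:- \<xi> i, 1:])"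
  shows "alg_inv p n \<xi> 1 (init_state p n \<xi>)"
proof -
  let ?st = "init_state p n \<xi>"
  define F where "F j q = lin 1 (- \<xi> j) * q (j - 1)" for j and q :: "nat \<Rightarrow> bipoly"
  have qs: "qs ?st = fold (\<lambda>j q. q(j := F j q)) [1..<n] ((\<lambda>_. 0)(0 := 1))"
    by (simp add: init_state_def Let_def F_def)
  have rec: "qs ?st j = (if 1 \<le> j \<and> j < n then F j (qs ?st) else ((\<lambda>_. 0)(0 := 1)) j)" for j
    unfolding qs by (rule fold_fun_upd_recursion) (simp add: F_def)
  have beta: "beta ?st j 1 = - \<xi> j" for j
    by (simp add: init_state_def Let_def)
  have lr: "lin_recurrence (alpha_coef n ?st) (beta ?st) (n - 1) 1 (qs ?st)"
  proof -
    have "qs ?st j = (\<Sum>l=1..min 1 j. lin (alpha_coef n ?st j l) (beta ?st j l) * qs ?st (j - l))"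
      if "j \<in> {1..n - 1}" for j
    proof -
      have "min 1 j = 1" "j < n" using that by auto
      then show ?thesis
        using rec[of j] that beta[of j] by (simp add: F_def alpha_coef_def)
    qed
    then show ?thesis using rec[of 0] by (simp add: lin_recurrence_def)
  qed
  have res: "res ?st = p - bconst (bcoeff p n 0) * varx * qs ?st (n - 1)"
    by (simp add: init_state_def Let_def)
  note top = hom_part_lin_recurrence[OF lr, of "n - 1" \<xi>]
  have "hom_part d (res ?st) = 0" if "d > n - 1" for d
  proof (cases "d = n")
    case True
    then have "d = Suc (n - 1)" using \<open>n > 0\<close> by simp
    then have "hom_part d (bconst (bcoeff p n 0) * varx * qs ?st (n - 1)) = hom_part n p"
      using top beta by (simp add: hom_part_const_varx_mult hom_part_top assms(3) lead alpha_coef_def)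
    then show ?thesis using True by (simp add: res)
  next
    case False
    define d' where "d' = d - 1"
    have d': "d = Suc d'" "d' > n - 1" using False that \<open>n > 0\<close> by (auto simp: d'_def)
    then have "hom_part d' (qs ?st (n - 1)) = 0"
      using top beta by (simp add: alpha_coef_def)
    moreover have "hom_part d p = 0"
      using False that assms(1) by (intro hom_part_eq_0_of_total_degree) simp
    ultimately show ?thesis by (simp add: res d' hom_part_const_varx_mult)
  qed
  then show ?thesis
    unfolding alg_inv_def using lr beta assms(4) by (simp add: res bcoeff_const_varx_mult)
qed

text \<open>Pass \<open>k\<close> alters coefficients only at \<open>l = k\<close>, which the
  cut-off \<open>k - 1\<close> does not see. So the old and the new sequence can be compared under
  the same coefficients.\<close>

lemma lin_recurrence_update_state:
  assumes k: "2 \<le> k" "k < n"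
    and inv: "alg_inv p n \<xi> (k - 1) st" and st': "st' = update_state p n \<xi> k v st"
  shows "lin_recurrence (alpha_coef n st') (beta st') (n - 1) (k - 1) (qs st)"
    and "lin_recurrence (alpha_coef n st') (beta st') (n - 1) k (qs st')"
    and "beta st' j 1 = - \<xi> j"
proof -
  have alpha: "alpha st' = (alpha st)(k := alpha_val p n k (res st))"
    and beta: "beta st' = (\<lambda>i j. if j = k \<and> k \<le> i \<and> i < n then v $ (i - k) else beta st i j)"
    by (simp_all add: st' update_state_def Let_def)
  have lr: "lin_recurrence (alpha_coef n st) (beta st) (n - 1) (k - 1) (qs st)"
    and beta1: "beta st j 1 = - \<xi> j" for j
    using inv by (simp_all add: alg_inv_def)
  show beta1': "beta st' j 1 = - \<xi> j" for j
    using k beta1 by (simp add: beta)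
  show lr': "lin_recurrence (alpha_coef n st') (beta st') (n - 1) (k - 1) (qs st)"
    unfolding lin_recurrence_def
  proof (intro conjI ballI)
    show "qs st 0 = 1" using lr by (simp add: lin_recurrence_def)
    fix j assume "j \<in> {1..n - 1}"
    with lr have "qs st j = (\<Sum>l=1..min (k - 1) j. lin (alpha_coef n st j l) (beta st j l) * qs st (j - l))"
      unfolding lin_recurrence_def by blast
    also have "\<dots> = (\<Sum>l=1..min (k - 1) j. lin (alpha_coef n st' j l) (beta st' j l) * qs st (j - l))"
      using k by (intro sum.cong refl) (auto simp: alpha_coef_def alpha beta)
    finally show "qs st j = \<dots>" .
  qed
  define q0 where "q0 = qs st"
  define q1 where "q1 = q0(k := q0 k + lin 1 (beta st' k k) * q0 0)"
  define F where "F j q = lin 1 (- \<xi> j) * q (j - 1) + (\<Sum>l=2..k. lin 1 (beta st' j l) * q (j - l))"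
    for j and q :: "nat \<Rightarrow> bipoly"
  define q2 where "q2 = fold (\<lambda>j q. q(j := F j q)) [k + 1..<n - 1] q1"
  define q where "q = qs st'"
  have q_upd: "q = q2(n - 1 := lin 1 (- \<xi> (n - 1)) * q2 (n - 2)
       + (\<Sum>l=2..k. lin (alpha st' l) (beta st' (n - 1) l) * q2 (n - 1 - l)))"
    by (simp only: q_def q2_def q1_def q0_def F_def st' update_state_def Let_def alg_state.select_convs)
  have q2: "q2 j = (if k + 1 \<le> j \<and> j < n - 1 then F j q2 else q1 j)" for j
    unfolding q2_def by (rule fold_fun_upd_recursion) (auto simp: F_def intro!: sum.cong)
  have low: "q j = q0 j" if "j < k" for j
    using that k by (simp add: q_upd q2 q1_def)
  have split: "{1..k} = insert 1 {2..k}" using k by auto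
  have sum_k: "(\<Sum>l=1..k. lin (alpha_coef n st' j l) (beta st' j l) * q (j - l)) =
      lin 1 (- \<xi> j) * q (j - 1) + (\<Sum>l=2..k. lin (alpha_coef n st' j l) (beta st' j l) * q (j - l))" for j
    unfolding split using beta1'[of j] by (simp add: alpha_coef_def)
  show "lin_recurrence (alpha_coef n st') (beta st') (n - 1) k (qs st')"
    unfolding lin_recurrence_def q_def[symmetric]
  proof (intro conjI ballI)
    show "q 0 = 1" using low[of 0] k lr by (simp add: lin_recurrence_def q0_def)
    fix j assume j: "j \<in> {1..n - 1}"
    let ?S = "\<lambda>m q. \<Sum>l=1..m. lin (alpha_coef n st' j l) (beta st' j l) * q (j - l)"
    have q0j: "q0 j = ?S (min (k - 1) j) q0"
      using lr' j unfolding lin_recurrence_def q0_def by blast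
    consider "j = n - 1" | "j < k" "j < n - 1" | "j = k" "j < n - 1" | "k < j" "j < n - 1"
      using j by (cases "j < k"; cases "j = n - 1"; cases "j = k") auto
    then show "q j = ?S (min k j) q"
    proof cases
      \<comment> \<open>For \<open>k = n - 1\<close> the value that \<open>q1\<close> puts at this
        position is overwritten, so the \<open>\<alpha>\<close> coefficients prevail; only positions
        below \<open>n - 1\<close> are read from \<open>q2\<close>.\<close>
      case 1
      have "q j = lin 1 (- \<xi> j) * q2 (n - 2) + (\<Sum>l=2..k. lin (alpha st' l) (beta st' j l) * q2 (j - l))"
        using 1 by (simp add: q_upd)
      also have "q2 (n - 2) = q (j - 1)"
        using k 1 by (simp add: q_upd numeral_2_eq_2)
      also have "(\<Sum>l=2..k. lin (alpha st' l) (beta st' j l) * q2 (j - l)) =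
          (\<Sum>l=2..k. lin (alpha_coef n st' j l) (beta st' j l) * q (j - l))"
        using k 1 by (intro sum.cong refl) (auto simp: alpha_coef_def q_upd)
      finally show ?thesis using sum_k[of j] k 1 by (simp add: min_absorb1)
    next
      case 2
      then have "min k j = j" "min (k - 1) j = j" by auto
      moreover have "?S j q0 = ?S j q"
        using 2 low by (intro sum.cong refl) auto
      ultimately show ?thesis using q0j low 2 by simp
    next
      \<comment> \<open>Adding one term to the old value suffices, since all positions below
        \<open>k\<close> are unchanged.\<close>
      case 3
      have "q j = q0 j + lin 1 (beta st' j j) * q0 0"
        using 3 by (simp add: q_upd q2 q1_def)
      also have "\<dots> = ?S (k - 1) q0 + lin 1 (beta st' j k) * q0 (j - k)"
        using q0j 3 by simp
      also have "?S (k - 1) q0 = ?S (k - 1) q"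
        using 3 low by (intro sum.cong refl) auto
      also have "?S (k - 1) q + lin 1 (beta st' j k) * q0 (j - k) = ?S k q"
        using k 3 low[of 0] by (cases k) (simp_all add: alpha_coef_def)
      finally show ?thesis using 3 by simp
    next
      case 4
      have "q j = F j q2" using 4 by (simp add: q_upd q2[of j])
      also have "\<dots> = F j q" using 4 by (auto simp: F_def q_upd intro!: sum.cong)
      also have "\<dots> = ?S k q"
        unfolding sum_k using 4 by (simp add: F_def alpha_coef_def)
      finally show ?thesis using 4 by (simp add: min_absorb1)
    qed
  qed
qed

lemma alg_inv_update_state:
  assumes k: "2 \<le> k" "k < n" and pn0: "bcoeff p n 0 \<noteq> 0"
    and inj: "inj_on \<xi> {1..n - 1}" and nz: "\<And>i. i \<in> {1..n - 1} \<Longrightarrow> \<xi> i \<noteq> 0"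
    and inv: "alg_inv p n \<xi> (k - 1) st" and v: "v \<in> carrier_vec (n - k)"
    and sys: "system_mat n \<xi> k *\<^sub>v v = system_rhs p n \<xi> k (res st)"
  shows "alg_inv p n \<xi> k (update_state p n \<xi> k v st)"
proof -
  define st' where "st' = update_state p n \<xi> k v st"
  define q where "q = qs st'"
  define q0 where "q0 = qs st"
  define P where "P = bcoeff p n 0"
  define s where "s = p - bconst P * varx * q (n - 1) - (\<Sum>l=2..k - 1. bconst (gamma st (n - l)) * q (n - l))"
  define c where "c = (-1) ^ (n - k) * bcoeff s 0 (n - k) / (\<Prod>i=1..n - k. \<xi> i)"
  have fields: "res st' = s - bconst c * q (n - k)" "gamma st' = (gamma st)(n - k := c)"
    by (simp_all only: c_def s_def q_def P_def st'_def update_state_def Let_def alg_state.select_convs)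
  have fields': "alpha st' k = alpha_val p n k (res st)" "\<And>i. k \<le> i \<Longrightarrow> i < n \<Longrightarrow> beta st' i k = v $ (i - k)"
    by (simp_all add: st'_def update_state_def Let_def)
  note rec = lin_recurrence_update_state[OF k inv st'_def]
  let ?a = "alpha_coef n st'" and ?b = "beta st'"
  have ab: "?a j 1 = 1 \<and> ?b j 1 = - \<xi> j" if "j \<in> {1..n - 1}" for j
    using rec(3) by (simp add: alpha_coef_def)
  note diff = hom_part_lin_recurrence_diff[OF rec(1,2) k(1) _ ab, folded q_def q0_def]
  have res: "res st = p - bconst P * varx * q0 (n - 1) - (\<Sum>l=2..k - 1. bconst (gamma st (n - l)) * q0 (n - l))"
    and res_deg: "\<And>d. d > n - (k - 1) \<Longrightarrow> hom_part d (res st) = 0"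
    and res_0: "bcoeff (res st) 0 (n - k + 1) = 0"
  proof -
    have "n - k + 1 = n - (k - 1)" using k by simp
    then show "res st = p - bconst P * varx * q0 (n - 1) - (\<Sum>l=2..k - 1. bconst (gamma st (n - l)) * q0 (n - l))"
      "\<And>d. d > n - (k - 1) \<Longrightarrow> hom_part d (res st) = 0" "bcoeff (res st) 0 (n - k + 1) = 0"
      using inv[unfolded alg_inv_def, folded P_def q0_def] by metis+
  qed
  \<comment> \<open>The earlier \<open>\<gamma>\<close> are kept while their \<open>q\<close> are
    recomputed, so the changes of those \<open>q\<close> enter \<open>s\<close> as well.\<close>
  have s_diff: "s = res st - bconst P * varx * (q (n - 1) - q0 (n - 1))
      - (\<Sum>l=2..k - 1. bconst (gamma st (n - l)) * (q (n - l) - q0 (n - l)))"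
    by (simp add: s_def res right_diff_distrib sum_subtractf)
  have s_hom: "hom_part d s = 0" if d: "d > n - k" for d
  proof -
    obtain d' where d': "d = Suc d'" "d' \<ge> n - k" using d by (cases d) auto
    \<comment> \<open>For \<open>l \<ge> 2\<close> the change of \<open>q (n - l)\<close> stays in
      degrees below \<open>n - k\<close>.\<close>
    have "hom_part d (q (n - l) - q0 (n - l)) = 0" if "l \<in> {2..k - 1}" for l
      using that k d diff[of "n - l"] by auto
    then have "hom_part d (\<Sum>l=2..k - 1. bconst (gamma st (n - l)) * (q (n - l) - q0 (n - l))) = 0"
      by (simp only: hom_part_sum hom_part_simps(4) smult_0_right sum.neutral_const cong: sum.cong)
    moreover have "hom_part d (res st) = hom_part d (bconst P * varx * (q (n - 1) - q0 (n - 1)))"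
    \<comment> \<open>Degree \<open>n - k + 1\<close> is the decisive one: there the change of
      \<open>q (n - 1)\<close> contributes \<open>h\<close>, built to match the top form of the
      residual. In higher degrees both sides vanish.\<close>
    proof (cases "d' = n - k")
      case True
      have "hom_part (n - k) (q (n - 1) - q0 (n - 1)) =
          (\<Sum>l=k..n - 1. [:?b l k, ?a l k:] * (\<Prod>i=1..l - k. [:- \<xi> i, 1:]) * (\<Prod>i=l + 1..n - 1. [:- \<xi> i, 1:]))"
        using diff[of "n - 1"] k by simp
      also have "\<dots> = h_poly p n k (res st)"
        unfolding h_poly_interpolation[OF k inj v sys]
      proof (intro sum.cong refl)
        fix l assume "l \<in> {k..n - 1}"
        then have "?b l k = v $ (l - k)" "?a l k = (if l = n - 1 then alpha_val p n k (res st) else 1)"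
          using k fields'(2)[of l] by (auto simp: fields'(1) alpha_coef_def)
        then show "[:?b l k, ?a l k:] * (\<Prod>i=1..l - k. [:- \<xi> i, 1:]) * (\<Prod>i=l + 1..n - 1. [:- \<xi> i, 1:]) =
            [:v $ (l - k), if l = n - 1 then alpha_val p n k (res st) else 1:] * basis_poly n \<xi> k l"
          by (simp only: mult.assoc)
      qed
      finally show ?thesis
        unfolding d' True hom_part_const_varx_mult hom_part_h_poly[OF res_0 pn0] P_def by simp
    next
      case False
      then have "hom_part d' (q (n - 1) - q0 (n - 1)) = 0"
        using d' k diff[of "n - 1"] by auto
      moreover have "hom_part d (res st) = 0"
        using False d' k by (intro res_deg) auto
      ultimately show ?thesis
        unfolding d' hom_part_const_varx_mult by simp
    qed
    ultimately show ?thesis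
      by (subst s_diff) (simp only: hom_part_simps, simp)
  qed
  have qk: "hom_part (n - k) (q (n - k)) = (\<Prod>i=1..n - k. [:- \<xi> i, 1:])"
    "\<And>d. d > n - k \<Longrightarrow> hom_part d (q (n - k)) = 0"
    using hom_part_lin_recurrence[OF rec(2) _ _ ab, of "n - k"] k by (auto simp: q_def)
  \<comment> \<open>The coefficient of the pure power of \<open>y\<close> is the dehomogenised form
    at \<open>t = 0\<close>, a product of the \<open>- \<xi> i\<close>; this explains the sign and
    the denominator in \<open>c\<close>.\<close>
  have "bcoeff (q (n - k)) 0 (n - k) = poly (hom_part (n - k) (q (n - k))) 0"
    by (simp add: bcoeff_eq_hom_part poly_0_coeff_0)
  also have "\<dots> = (\<Prod>i=1..n - k. - \<xi> i)"
    by (simp add: qk poly_prod)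
  also have "\<dots> = (-1) ^ (n - k) * (\<Prod>i=1..n - k. \<xi> i)"
    using prod_uminus[of \<xi> "{1..n - k}"] by simp
  finally have "c * bcoeff (q (n - k)) 0 (n - k) = bcoeff s 0 (n - k)"
  proof -
    assume *: "bcoeff (q (n - k)) 0 (n - k) = (-1) ^ (n - k) * (\<Prod>i=1..n - k. \<xi> i)"
    have "\<xi> i \<noteq> 0" if "i \<in> {1..n - k}" for i
      using that k by (intro nz) auto
    then have "(\<Prod>i=1..n - k. \<xi> i) \<noteq> 0" by simp
    moreover have "(-1) ^ (n - k) * t / x * ((-1) ^ (n - k) * x) = t" if "x \<noteq> 0" for t x :: complex
      using that by (simp add: field_simps)
    ultimately show ?thesis
      unfolding * c_def by blast
  qed
  then have res'_0: "bcoeff (res st') 0 (n - k) = 0"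
    by (simp add: fields)
  have res'_hom: "hom_part d (res st') = 0" if "d > n - k" for d
    using s_hom[OF that] qk(2)[OF that] by (simp add: fields)
  have "(\<Sum>l=2..k. bconst (gamma st' (n - l)) * q (n - l)) =
      (\<Sum>l=2..k - 1. bconst (gamma st' (n - l)) * q (n - l)) + bconst c * q (n - k)"
    using k by (cases k) (simp_all add: fields)
  also have "(\<Sum>l=2..k - 1. bconst (gamma st' (n - l)) * q (n - l)) =
      (\<Sum>l=2..k - 1. bconst (gamma st (n - l)) * q (n - l))"
    using k by (intro sum.cong refl) (auto simp: fields)
  finally have "res st' = p - bconst P * varx * q (n - 1) - (\<Sum>l=2..k. bconst (gamma st' (n - l)) * q (n - l))"
    by (simp add: fields s_def)
  then show ?thesis
    unfolding alg_inv_def st'_def[symmetric]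
    using rec(2,3) res'_hom res'_0 by (simp add: q_def P_def)
qed

section \<open>Existence and uniqueness of the run\<close>

lemma step_unique:
  assumes "inj_on \<xi> {1..n - 1}" "2 \<le> k"
  shows "\<exists>!st'. step p n \<xi> k st st'"
proof -
  \<comment> \<open>The solution \<open>v\<close> is the only choice in a step, so invertibility
    makes the step both possible and deterministic.\<close>
  have "\<exists>!v. v \<in> carrier_vec (n - k) \<and> system_mat n \<xi> k *\<^sub>v v = system_rhs p n \<xi> k (res st)"
    using det_system_mat[OF assms]
    by (intro ex1_mult_mat_vec) (simp_all add: system_mat_def system_rhs_def)
  then show ?thesis unfolding step_def by (smt (verit, best))
qed

lemma loop_unique:
  assumes "inj_on \<xi> {1..n - 1}" "\<forall>k\<in>set ks. 2 \<le> k"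
  shows "\<exists>!st'. loop p n \<xi> ks st st'"
  using assms(2)
proof (induction ks arbitrary: st)
  case (Cons k ks)
  have "\<exists>!st'. step p n \<xi> k st st'"
    using Cons.prems by (intro step_unique[OF assms(1)]) simp
  then obtain st1 where st1: "step p n \<xi> k st st1" "\<And>st'. step p n \<xi> k st st' \<Longrightarrow> st' = st1"
    by blast
  then have "loop p n \<xi> (k # ks) st st' \<longleftrightarrow> loop p n \<xi> ks st1 st'" for st'
    unfolding loop.simps using st1 by metis
  moreover have "\<exists>!st'. loop p n \<xi> ks st1 st'"
    using Cons.prems by (intro Cons.IH) simp
  ultimately show ?case by presburger
next
  case Nil
  show ?case by simp
qed

lemma alg_inv_loop:
  assumes pn0: "bcoeff p n 0 \<noteq> 0" and inj: "inj_on \<xi> {1..n - 1}"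
    and nz: "\<And>i. i \<in> {1..n - 1} \<Longrightarrow> \<xi> i \<noteq> 0"
    and "loop p n \<xi> [m..<n] st st'" "alg_inv p n \<xi> (m - 1) st" "2 \<le> m" "m \<le> n"
  shows "alg_inv p n \<xi> (n - 1) st'"
  using assms(4-7)
proof (induction "n - m" arbitrary: m st)
  case 0
  then show ?case by simp
next
  case (Suc i)
  then have m: "m < n" by simp
  with Suc.prems obtain st1 where st1: "step p n \<xi> m st st1" "loop p n \<xi> [Suc m..<n] st1 st'"
    by (auto simp: upt_conv_Cons)
  have "alg_inv p n \<xi> m st1"
    using st1(1) alg_inv_update_state[OF Suc.prems(3) m pn0 inj nz Suc.prems(2)]
    by (auto simp: step_def)
  then show ?case
    using Suc.hyps m st1(2) Suc.prems(3) by (intro Suc.hyps(1)[of "Suc m"]) auto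
qed

section \<open>The determinant of the returned pencil\<close>

lemma pencil_index:
  assumes "A \<in> carrier_mat n n" "B \<in> carrier_mat n n" "C \<in> carrier_mat n n" "i < n" "j < n"
  shows "(map_mat bconst A + varx \<cdot>\<^sub>m map_mat bconst B + vary \<cdot>\<^sub>m map_mat bconst C) $$ (i, j) =
    bconst (A $$ (i, j)) + lin (B $$ (i, j)) (C $$ (i, j))"
  using assms by (simp add: lin_def mult.commute add.assoc)

lemma bconst_simps [simp]: "bconst 0 = 0" "bconst 1 = 1" "bconst (- a) = - bconst a"
  by (simp_all add: bconst_def one_pCons)

lemma lin_uminus: "lin (- a) (- b) = - lin a b"
  by (simp add: lin_def)

lemma lin_zero [simp]: "lin 0 0 = 0" "lin a 0 = bconst a * varx"
  by (simp_all add: lin_def)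

text \<open>For \<open>n \<ge> 2\<close> the corner of the pencil has room only for a constant and a
  multiple of \<open>x\<close>; this makes the final residual fit there.\<close>

lemma affine_bipoly:
  assumes "\<And>d. d > 1 \<Longrightarrow> hom_part d r = 0" "bcoeff r 0 1 = 0"
  shows "r = bconst (bcoeff r 0 0) + bconst (bcoeff r 1 0) * varx"
proof (rule bipoly_eqI)
  fix i j
  have "bcoeff (bconst c) i j = (if i = 0 \<and> j = 0 then c else 0)" for c
    by (auto simp: bcoeff_def bconst_def coeff_pCons split: nat.splits)
  moreover have "bcoeff (bconst c * varx) i j = (if i = 1 \<and> j = 0 then c else 0)" for c
    by (auto simp: bcoeff_def bconst_def varx_def coeff_pCons split: nat.splits)
  moreover have "bcoeff r i j = 0" if "i + j > 1"
    using assms(1)[OF that] by (simp add: bcoeff_eq_hom_part)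
  moreover have "i + j > 1 \<or> (i, j) \<in> {(0, 0), (0, 1), (1, 0)}"
    by auto
  ultimately show "bcoeff r i j = bcoeff (bconst (bcoeff r 0 0) + bconst (bcoeff r 1 0) * varx) i j"
    using assms(2) by auto
qed

text \<open>The value \<open>max 1 (n - 1)\<close> covers \<open>n = 1\<close>, where no pass is
  made and the invariant is that of the initial state.\<close>

lemma det_output:
  assumes n: "n > 0" and inv: "alg_inv p n \<xi> k st" and k: "k = max 1 (n - 1)"
  shows "det (map_mat bconst (out_A n st) + varx \<cdot>\<^sub>m map_mat bconst (out_B p n st)
      + vary \<cdot>\<^sub>m map_mat bconst (out_C n st)) = p"
proof -
  define M where "M = map_mat bconst (out_A n st) + varx \<cdot>\<^sub>m map_mat bconst (out_B p n st)
      + vary \<cdot>\<^sub>m map_mat bconst (out_C n st)"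
  define q where "q = qs st"
  have carr: "out_A n st \<in> carrier_mat n n" "out_B p n st \<in> carrier_mat n n" "out_C n st \<in> carrier_mat n n"
    by (simp_all add: out_A_def out_B_def out_C_def)
  have M: "M \<in> carrier_mat n n" using carr by (simp add: M_def)
  have idx: "M $$ (i, j) = bconst (out_A n st $$ (i, j)) + lin (out_B p n st $$ (i, j)) (out_C n st $$ (i, j))"
    if "i < n" "j < n" for i j
    unfolding M_def by (rule pencil_index[OF carr that])
  have lr: "lin_recurrence (alpha_coef n st) (beta st) (n - 1) k q"
    and res: "res st = p - bconst (bcoeff p n 0) * varx * q (n - 1)
       - (\<Sum>l=2..k. bconst (gamma st (n - l)) * q (n - l))"
    and res_deg: "\<And>d. d > n - k \<Longrightarrow> hom_part d (res st) = 0"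
    and res_0: "bcoeff (res st) 0 (n - k) = 0"
    using inv unfolding alg_inv_def q_def by blast+
  have q0: "q 0 = 1" using lr by (simp add: lin_recurrence_def)
  have low: "M $$ (i, j) = - lin (alpha_coef n st i (i - j)) (beta st i (i - j))" if "j < i" "i < n" for i j
  proof -
    have "i = n - 1 \<and> j < n - 2 \<longleftrightarrow> i = n - 1 \<and> 2 \<le> i - j" using that by auto
    then show ?thesis
      using that by (subst idx) (auto simp: out_A_def out_B_def out_C_def alpha_coef_def lin_uminus)
  qed
  have upper: "M $$ (i, j) = 0" if "0 < i" "i < j" "j < n" for i j
    using that by (subst idx) (auto simp: out_A_def out_B_def out_C_def)
  have diag: "M $$ (i, i) = 1" if "0 < i" "i < n" for i
    using that by (subst idx) (auto simp: out_A_def out_B_def out_C_def)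
  have ker: "(\<Sum>j<n. M $$ (i, j) * q j) = 0" if i: "0 < i" "i < n" for i
  proof -
    have "(\<Sum>j<n. M $$ (i, j) * q j) = (\<Sum>j<Suc i. M $$ (i, j) * q j)"
      using i by (intro sum.mono_neutral_right) (auto simp: upper)
    also have "\<dots> = q i + (\<Sum>j<i. M $$ (i, j) * q j)"
      using i by (simp add: diag)
    also have "(\<Sum>j<i. M $$ (i, j) * q j) = (\<Sum>l=1..i. M $$ (i, i - l) * q (i - l))"
      by (rule sum.reindex_bij_witness[of _ "\<lambda>l. i - l" "\<lambda>j. i - j"]) auto
    also have "\<dots> = (\<Sum>l=1..i. - (lin (alpha_coef n st i l) (beta st i l) * q (i - l)))"
      using i by (intro sum.cong refl) (auto simp: low)
    also have "\<dots> = - q i"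
    proof -
      have "q i = (\<Sum>l=1..min k i. lin (alpha_coef n st i l) (beta st i l) * q (i - l))"
        using lr i by (auto simp: lin_recurrence_def)
      \<comment> \<open>All subdiagonals are filled by now, so the cut-off is inactive.\<close>
      moreover have "min k i = i" using i k by auto
      ultimately show ?thesis by (simp add: sum_negf)
    qed
    finally show ?thesis by simp
  qed
  have "det M = (\<Sum>j<n. M $$ (0, j) * q j)"
    by (rule det_eq_first_row_sum[OF M n q0 upper diag ker])
  also have "\<dots> = p"
  proof (cases "n = 1")
    case True
    \<comment> \<open>With \<open>n = k = 1\<close> the invariant excludes terms of positive degree
      and the constant term alike. So nothing is lost when the last entry of the first row takes the
      place of the residual.\<close>
    then have "bcoeff (res st) i j = 0" for i j
      using res_deg[of "i + j"] res_0 k by (cases "i + j = 0") (auto simp: bcoeff_eq_hom_part)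
    then have "res st = 0" by (intro bipoly_eqI) simp
    moreover have "M $$ (0, 0) = bconst (bcoeff p n 0) * varx"
      using True by (subst idx) (auto simp: out_A_def out_B_def out_C_def)
    ultimately show ?thesis using res True k by (simp add: q0)
  next
    case False
    then obtain m where m: "n = Suc (Suc m)" using n by (metis One_nat_def not0_implies_Suc neq0_conv)
    have r: "res st = bconst (bcoeff (res st) 0 0) + bconst (bcoeff (res st) 1 0) * varx"
      using res_deg res_0 m k by (intro affine_bipoly) auto
    have first: "M $$ (0, 0) = res st"
      by (subst r, subst idx) (auto simp: out_A_def out_B_def out_C_def m)
    have last: "M $$ (0, n - 1) = bconst (bcoeff p n 0) * varx"
      by (subst idx) (auto simp: out_A_def out_B_def out_C_def m)
    have middle: "M $$ (0, j) = bconst (gamma st j)" if "j \<in> {1..m}" for j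
      using that by (subst idx) (auto simp: out_A_def out_B_def out_C_def m)
    have "{..<n} = insert 0 (insert (n - 1) {1..m})" using m by auto
    then have "(\<Sum>j<n. M $$ (0, j) * q j) =
        M $$ (0, 0) * q 0 + (M $$ (0, n - 1) * q (n - 1) + (\<Sum>j=1..m. M $$ (0, j) * q j))"
      by (simp add: m)
    also have "(\<Sum>j=1..m. M $$ (0, j) * q j) = (\<Sum>j=1..m. bconst (gamma st j) * q j)"
      by (intro sum.cong refl) (simp only: middle)
    \<comment> \<open>Column \<open>j\<close> of the first row holds the \<open>\<gamma>\<close> of
      pass \<open>l = n - j\<close>.\<close>
    also have "\<dots> = (\<Sum>l=2..n - 1. bconst (gamma st (n - l)) * q (n - l))"
      by (rule sum.reindex_bij_witness[of _ "\<lambda>l. n - l" "\<lambda>j. n - j"]) (auto simp: m)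
    finally show ?thesis
      unfolding first last q0 using res k m by simp
  qed
  finally show ?thesis by (simp add: M_def)
qed

theorem mainTheorem1:
  fixes p :: "complex poly poly" and n :: nat
  assumes "total_degree p = n"
    and "bcoeff p n 0 \<noteq> 0"
    and "bcoeff p 0 n = 0"
    and "bcoeff p 0 (n - 1) = 0"
    and "\<forall>z. poly (lead_poly p n) z = 0 \<longrightarrow> order z (lead_poly p n) = 1 \<and> z \<noteq> 0"
  shows "(\<exists>\<xi>. root_enumeration p n \<xi>) \<and>
    (\<forall>\<xi>. root_enumeration p n \<xi> \<longrightarrow>
      (\<exists>!M. alg_output p n \<xi> M) \<and>
      (\<forall>A B C. alg_output p n \<xi> (A, B, C) \<longrightarrow>
        A \<in> carrier_mat n n \<and> B \<in> carrier_mat n n \<and> C \<in> carrier_mat n n \<and>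
        det (map_mat bconst A + varx \<cdot>\<^sub>m map_mat bconst B + vary \<cdot>\<^sub>m map_mat bconst C) = p))"
proof -
  \<comment> \<open>For \<open>n = 0\<close> the coefficients \<open>bcoeff p n 0\<close> and
    \<open>bcoeff p 0 n\<close> would coincide.\<close>
  have n: "n > 0" using assms(2,3) by (cases n) auto
  have simple: "order z (lead_poly p n) = 1" if "poly (lead_poly p n) z = 0" for z
    using assms(5) that by blast
  show ?thesis
  proof (intro conjI allI impI)
    show "\<exists>\<xi>. root_enumeration p n \<xi>"
      by (rule root_enumeration_exists[OF n assms(2) simple])
  next
    fix \<xi> assume enum: "root_enumeration p n \<xi>"
    then have inj: "inj_on \<xi> {1..n - 1}"
      by (simp add: root_enumeration_def bij_betw_def)
    have "\<exists>!st. loop p n \<xi> [2..<n] (init_state p n \<xi>) st"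
      by (rule loop_unique[OF inj]) simp
    then show "\<exists>!M. alg_output p n \<xi> M"
      unfolding alg_output_def by metis
  next
    fix \<xi> A B C assume enum: "root_enumeration p n \<xi>" and out: "alg_output p n \<xi> (A, B, C)"
    have inj: "inj_on \<xi> {1..n - 1}" and roots: "\<xi> ` {1..n - 1} = {z. poly (lead_poly p n) z = 0}"
      using enum by (simp_all add: root_enumeration_def bij_betw_def)
    have nz: "\<xi> i \<noteq> 0" if "i \<in> {1..n - 1}" for i
      using that roots assms(5) by blast
    obtain st where st: "loop p n \<xi> [2..<n] (init_state p n \<xi>) st"
      and ABC: "A = out_A n st" "B = out_B p n st" "C = out_C n st"
      using out by (auto simp: alg_output_def)
    have init: "alg_inv p n \<xi> 1 (init_state p n \<xi>)"
      by (rule alg_inv_init[OF assms(1-4) n lead_poly_root_enumeration[OF n assms(2) simple enum]])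
    have "alg_inv p n \<xi> (max 1 (n - 1)) st"
    proof (cases "n = 1")
      case True
      then show ?thesis using init st by simp
    next
      case False
      then have "alg_inv p n \<xi> (n - 1) st" "max 1 (n - 1) = n - 1"
        using alg_inv_loop[OF assms(2) inj nz st] init n by auto
      then show ?thesis by simp
    qed
    from det_output[OF n this refl]
    show "det (map_mat bconst A + varx \<cdot>\<^sub>m map_mat bconst B + vary \<cdot>\<^sub>m map_mat bconst C) = p"
      by (simp add: ABC)
    show "A \<in> carrier_mat n n" "B \<in> carrier_mat n n" "C \<in> carrier_mat n n"
      by (simp_all add: ABC out_A_def out_B_def out_C_def)
  qed
qed

end
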